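(* Let $H$ be a $3$-uniform hypergraph with $\chi_S(H)>30$. Then there is no homomorphism $H\to 3\text{-}QI(10,2)$, no covering array $CA(10,H,2)$ exists, and $CAN(H,2)\ge 11$. Moreover, if there exists a homomorphism $H\to 3\text{-}QI(11,2)$, then $CAN(H,2)=11$.
   Context: The hypergraph $3\text{-}QI(n,2)$ is the $3$-uniform hypergraph whose vertices are all partitions $\{P,\overline{P}\}$ of $\{1,\dots,n\}$ into two classes, each class of size at least $4$. Three distinct vertices $\{P,\overline P\},\{Q,\overline Q\},\{R,\overline R\}$ form a hyperedge if and only if all eight intersections $P'\cap Q'\cap R'$ with $P'\in\{P,\overline P\}$, $Q'\in\{Q,\overline Q\}$, $R'\in\{R,\overline R\}$ are nonempty. A hypergraph here is a pair $H=(V,E)$ with $V$ finite, $E$ a family of nonempty subsets of $V$ (hyperedges) and $\bigcup_{e\in E}e=V$; it is $3$-uniform if every hyperedge has exactly $3$ vertices. A homomorphism between $3$-uniform hypergraphs is a map of vertices sending every hyperedge onto a hyperedge. A strong $k$-colouring of $H$ is a partition of $V$ into $k$ colour classes such that no two vertices belonging to a common hyperedge have the same colour; $\chi_S(H)$ is the minimum $k$ for which $H$ admits a strong $k$-colouring. For positive integers $n,g$, a covering array $CA(n,H,g)$ is an $n\times|V|$ array with entries from a fixed set $S$ of size $g$, with columns indexed by $V$, such that for every hyperedge $e\in E$ the $n\times|e|$ subarray on the columns of $e$ contains every ordered $|e|$-tuple from $S^{|e|}$ at least once as a row. $CAN(H,g)$ is the minimum $n$ for which a $CA(n,H,g)$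 exists. *)

theory Defs
  imports "HOL-Library.Disjoint_Sets" "HOL-Library.FuncSet"
begin

type_synonym 'a hypergraph = "'a set \<times> 'a set set"

abbreviation verts :: "'a hypergraph \<Rightarrow> 'a set" where
  "verts \<equiv> fst"

abbreviation hyperedges :: "'a hypergraph \<Rightarrow> 'a set set" where
  "hyperedges \<equiv> snd"

definition hypergraph :: "'a hypergraph \<Rightarrow> bool" where
  "hypergraph H \<longleftrightarrow>
     finite (verts H) \<and> (\<forall>e\<in>hyperedges H. e \<noteq> {}) \<and> \<Union>(hyperedges H) = verts H"

definition uniform :: "nat \<Rightarrow> 'a hypergraph \<Rightarrow> bool" where
  "uniform r H \<longleftrightarrow> hypergraph H \<and> (\<forall>e\<in>hyperedges H. card e = r)"

definition homomorphism :: "'a hypergraph \<Rightarrow> 'b hypergraph \<Rightarrow> ('a \<Rightarrow> 'b) \<Rightarrow> bool" where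
  "homomorphism H K f \<longleftrightarrow>
     f ` verts H \<subseteq> verts K \<and> (\<forall>e\<in>hyperedges H. f ` e \<in> hyperedges K)"

definition strong_colouring :: "'a hypergraph \<Rightarrow> 'a set set \<Rightarrow> nat \<Rightarrow> bool" where
  "strong_colouring H C k \<longleftrightarrow>
     partition_on (verts H) C \<and> finite C \<and> card C = k \<and>
     (\<forall>e\<in>hyperedges H. \<forall>u\<in>e. \<forall>v\<in>e. u \<noteq> v \<longrightarrow> \<not> (\<exists>X\<in>C. u \<in> X \<and> v \<in> X))"

definition strong_chromatic_number :: "'a hypergraph \<Rightarrow> nat" where
  "strong_chromatic_number H = (LEAST k. \<exists>C. strong_colouring H C k)"

text \<open>The entry of the array in row \<open>i\<close> and column \<open>v\<close> is \<open>A i v\<close>; the fixed symbol set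
  of size \<open>g\<close> is \<open>{0..<g}\<close>.\<close>

definition covering_array :: "nat \<Rightarrow> 'a hypergraph \<Rightarrow> nat \<Rightarrow> (nat \<Rightarrow> 'a \<Rightarrow> nat) \<Rightarrow> bool" where
  "covering_array n H g A \<longleftrightarrow>
     n > 0 \<and> g > 0 \<and>
     (\<forall>i\<in>{1..n}. \<forall>v\<in>verts H. A i v \<in> {0..<g}) \<and>
     (\<forall>e\<in>hyperedges H. \<forall>t \<in> e \<rightarrow>\<^sub>E {0..<g}. \<exists>i\<in>{1..n}. \<forall>v\<in>e. A i v = t v)"

definition CAN :: "'a hypergraph \<Rightarrow> nat \<Rightarrow> nat" where
  "CAN H g = (LEAST n. \<exists>A. covering_array n H g A)"

text \<open>The hypergraph \<open>3-QI(n,2)\<close>; a vertex is the two-element set \<open>{P, {1..n} - P}\<close>.\<close>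

definition QI3_verts :: "nat \<Rightarrow> nat set set set" where
  "QI3_verts n = {p. partition_on {1..n} p \<and> card p = 2 \<and> (\<forall>P\<in>p. card P \<ge> 4)}"

definition QI3 :: "nat \<Rightarrow> nat set set hypergraph" where
  "QI3 n = (QI3_verts n,
     {{p, q, r} | p q r. p \<in> QI3_verts n \<and> q \<in> QI3_verts n \<and> r \<in> QI3_verts n \<and>
        p \<noteq> q \<and> p \<noteq> r \<and> q \<noteq> r \<and> (\<forall>P\<in>p. \<forall>Q\<in>q. \<forall>R\<in>r. P \<inter> Q \<inter> R \<noteq> {})})"

end

theory Submission
  imports Defs
begin

text \<open>
  A binary array with \<open>n\<close> rows turns each column into a split of the row set \<open>{1..n}\<close> into the
  rows with entry \<open>0\<close> and the rows with entry \<open>1\<close>. The covering condition on a hyperedge says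
  exactly that the three splits meet in eight nonempty cells; each class of a split then contains
  four disjoint cells, so has size at least \<open>4\<close>. Hence covering arrays \<open>CA(n,H,2)\<close> and
  homomorphisms from \<open>H\<close> to \<open>3-QI(n,2)\<close> are the same thing
  (\<open>homomorphism_if_covering_array\<close>, \<open>covering_array_if_homomorphism\<close>). As rows can be
  repeated (\<open>covering_array_mono\<close>), every claim follows once no homomorphism to \<open>3-QI(10,2)\<close>
  exists. A homomorphism pulls strong colourings back, so it suffices to colour \<open>3-QI(10,2)\<close>
  strongly with \<open>30\<close> colours (\<open>QI3_10_strong_colouring\<close>).

  Two splits in a common hyperedge cross in four cells of size at least \<open>2\<close> each, because the
  third split divides every cell (\<open>QI3_edge_crossing\<close>). A colour class may therefore be any
  family of splits in which two members always have a cell of size at most \<open>1\<close>. Since a split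
  of ten points has type \<open>4|6\<close> or \<open>5|5\<close>, it is represented by a \<open>4\<close>-set or a \<open>5\<close>-set. Take
  \<open>T \<subseteq> S\<close> of sizes \<open>3\<close> and \<open>4\<close>, and a \<open>5\<close>-set \<open>Q\<close> disjoint from \<open>S\<close>. The \<open>4\<close>-sets
  containing \<open>T\<close>, the \<open>5\<close>-sets containing \<open>S\<close> and the \<open>4\<close>-subsets of \<open>Q\<close> together give such
  a family, of \<open>7 + 6 + 5 = 18\<close> splits (\<open>in_class_not_crossing\<close>). There are
  \<open>210 + 126 = 336\<close> splits, so \<open>30\<close> families leave some room for overlaps; six triples
  \<open>(T, S, Q)\<close> and their images under the permutation \<open>(1 2 3 4 5)(6 7 8 9 10)\<close> of order five
  cover all of them (\<open>cover4\<close>, \<open>cover5\<close>).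
\<close>

section \<open>Hyperedges of \<open>3-QI(n,2)\<close>\<close>

lemma QI3_vertsD:
  assumes "p \<in> QI3_verts n" "P \<in> p"
  shows "p = {P, {1..n} - P}" "P \<subseteq> {1..n}" "4 \<le> card P"
proof -
  have part: "partition_on {1..n} p" and "card p = 2" and big: "\<forall>P\<in>p. card P \<ge> 4"
    using assms(1) by (auto simp: QI3_verts_def)
  show "P \<subseteq> {1..n}" and "4 \<le> card P"
    using part big assms(2) by (auto simp: partition_on_def)
  from \<open>card p = 2\<close> assms(2) obtain P' where P': "p = {P, P'}" "P \<noteq> P'"
    by (auto simp: card_2_iff)
  then have "P \<inter> P' = {}" "P \<union> P' = {1..n}"
    using part by (auto simp: partition_on_def disjoint_def)
  then have "P' = {1..n} - P"
    by blast
  then show "p = {P, {1..n} - P}"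
    using P' by simp
qed

lemma QI3_vertsI:
  assumes "P \<subseteq> {1..n}" "4 \<le> card P" "4 \<le> card ({1..n} - P)"
  shows "{P, {1..n} - P} \<in> QI3_verts n"
proof -
  have "P \<noteq> {}" "{1..n} - P \<noteq> {}"
    using assms by (auto simp del: Diff_eq_empty_iff)
  then show ?thesis
    using assms by (auto simp: QI3_verts_def partition_on_def disjoint_def card_2_iff)
qed

text \<open>The eight-cell condition in terms of a choice \<open>h\<close> of one class from each split of the
  hyperedge, which avoids naming the three splits in some order.\<close>

lemma QI3_edge_cells:
  assumes "E \<in> hyperedges (QI3 n)" "\<And>p. p \<in> E \<Longrightarrow> h p \<in> p"
  shows "\<exists>i. \<forall>p\<in>E. i \<in> h p"
proof -
  obtain p q r where E: "E = {p, q, r}"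
    and cells: "\<forall>P\<in>p. \<forall>Q\<in>q. \<forall>R\<in>r. P \<inter> Q \<inter> R \<noteq> {}"
    using assms(1) by (auto simp: QI3_def)
  have "h p \<inter> h q \<inter> h r \<noteq> {}"
    using cells assms(2)[of p] assms(2)[of q] assms(2)[of r] E by blast
  then show ?thesis
    using E by blast
qed

lemma QI3_edgeI:
  assumes "E \<subseteq> QI3_verts n" "card E = 3"
    and cells: "\<And>h. (\<And>p. p \<in> E \<Longrightarrow> h p \<in> p) \<Longrightarrow> \<exists>i. \<forall>p\<in>E. i \<in> h p"
  shows "E \<in> hyperedges (QI3 n)"
proof -
  obtain p q r where E: "E = {p, q, r}" "p \<noteq> q" "p \<noteq> r" "q \<noteq> r"
    using assms(2) by (auto simp: card_3_iff)
  have "P \<inter> Q \<inter> R \<noteq> {}" if "P \<in> p" "Q \<in> q" "R \<in> r" for P Q R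
  proof -
    have "\<exists>i. \<forall>s\<in>E. i \<in> (if s = p then P else if s = q then Q else R)"
      by (rule cells) (use E that in auto)
    then show ?thesis
      using E by auto
  qed
  then have "\<forall>P\<in>p. \<forall>Q\<in>q. \<forall>R\<in>r. P \<inter> Q \<inter> R \<noteq> {}"
    by blast
  moreover have "p \<in> QI3_verts n" "q \<in> QI3_verts n" "r \<in> QI3_verts n"
    using E(1) assms(1) by auto
  ultimately show ?thesis
    using E unfolding QI3_def snd_conv mem_Collect_eq by blast
qed

lemma QI3_edgeD:
  assumes "E \<in> hyperedges (QI3 n)"
  shows "E \<subseteq> QI3_verts n" "card E = 3"
proof -
  obtain p q r where "E = {p, q, r}" "p \<in> QI3_verts n" "q \<in> QI3_verts n" "r \<in> QI3_verts n"
    "p \<noteq> q" "p \<noteq> r" "q \<noteq> r"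
    using assms unfolding QI3_def snd_conv mem_Collect_eq by blast
  then show "E \<subseteq> QI3_verts n" "card E = 3"
    by simp_all
qed

text \<open>The third split of the hyperedge has two disjoint classes, both of which meet \<open>X \<inter> Y\<close>.\<close>

lemma QI3_edge_crossing:
  assumes E: "E \<in> hyperedges (QI3 n)" "p \<in> E" "q \<in> E" "p \<noteq> q" and "X \<in> p" "Y \<in> q"
  shows "2 \<le> card (X \<inter> Y)"
proof -
  have V: "E \<subseteq> QI3_verts n" "card E = 3"
    using QI3_edgeD[OF E(1)] by auto
  then have "card (E - {p, q}) = 1"
    using E by (simp add: card_Diff_subset)
  then obtain r where "E - {p, q} = {r}"
    by (auto simp: card_1_singleton_iff)
  then have r: "r \<in> E" "r \<noteq> p" "r \<noteq> q" "E = {p, q, r}"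
    using E by auto
  have meet: "X \<inter> Y \<inter> R \<noteq> {}" if "R \<in> r" for R
  proof -
    have "\<exists>i. \<forall>s\<in>E. i \<in> (if s = p then X else if s = q then Y else R)"
      using that assms r by (intro QI3_edge_cells[OF E(1)]) auto
    then obtain i where "\<forall>s\<in>E. i \<in> (if s = p then X else if s = q then Y else R)"
      by blast
    then have "i \<in> X \<inter> Y \<inter> R"
      using r E(4) by simp
    then show ?thesis
      by blast
  qed
  have rV: "r \<in> QI3_verts n"
    using r V by blast
  then have "card r = 2"
    by (simp add: QI3_verts_def)
  then obtain R where R: "R \<in> r"
    by fastforce
  then have "{1..n} - R \<in> r"
    using QI3_vertsD(1)[OF rV R] by blast
  then obtain i j where ij: "i \<in> X \<inter> Y \<inter> R" "j \<in> X \<inter> Y \<inter> ({1..n} - R)"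
    using meet[OF R] meet[of "{1..n} - R"] by blast
  have "X \<subseteq> {1..n}"
    using QI3_vertsD(2) assms(5) V E(2) by blast
  then have "card {i, j} \<le> card (X \<inter> Y)"
    using ij by (intro card_mono) (auto intro: finite_subset)
  then show ?thesis
    using ij by (cases "i = j") auto
qed

lemma homomorphism_inj_on_edge:
  assumes "uniform 3 H" "homomorphism H (QI3 n) f" "e \<in> hyperedges H"
  shows "inj_on f e"
proof (rule eq_card_imp_inj_on)
  show "finite e"
    using assms by (auto simp: uniform_def intro: card_ge_0_finite)
  have "f ` e \<in> hyperedges (QI3 n)"
    using assms by (auto simp: homomorphism_def)
  then show "card (f ` e) = card e"
    using QI3_edgeD(2) assms by (auto simp: uniform_def)
qed

section \<open>Binary covering arrays as homomorphisms\<close>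

lemma covering_arrayD:
  assumes "covering_array n H g A" "e \<in> hyperedges H" "\<And>v. v \<in> e \<Longrightarrow> t v < g"
  shows "\<exists>i\<in>{1..n}. \<forall>v\<in>e. A i v = t v"
proof -
  have "restrict t e \<in> e \<rightarrow>\<^sub>E {0..<g}"
    using assms(3) by auto
  then obtain i where "i \<in> {1..n}" "\<forall>v\<in>e. A i v = restrict t e v"
    using assms(1,2) unfolding covering_array_def by blast
  then show ?thesis
    by auto
qed

text \<open>Each column is sent to the split of the rows by its entries.\<close>

lemma homomorphism_if_covering_array:
  assumes H: "uniform 3 H" and A: "covering_array n H 2 A"
  shows "\<exists>f. homomorphism H (QI3 n) f"
proof -
  define L where "L v a = {i\<in>{1..n}. A i v = a}" for v a
  define f where "f v = {L v 0, L v 1}" for v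
  have compl: "{1..n} - L v 0 = L v 1" if "v \<in> verts H" for v
  proof -
    have "\<forall>i\<in>{1..n}. A i v = 0 \<or> A i v = 1"
      using A that by (auto simp: covering_array_def less_2_cases_iff)
    then show ?thesis
      unfolding L_def by fastforce
  qed
  have edge3: "card e = 3" "finite e" "e \<subseteq> verts H" if "e \<in> hyperedges H" for e
    using H that by (auto simp: uniform_def hypergraph_def intro: card_ge_0_finite)
  have big: "4 \<le> card (L u a)" if e: "e \<in> hyperedges H" "u \<in> e" and "a < 2" for e u a
  proof -
    have "card (e - {u}) = 2"
      using edge3[OF e(1)] e(2) by simp
    then obtain v w where vw: "e - {u} = {v, w}" "v \<noteq> w"
      by (auto simp: card_2_iff)
    \<comment> \<open>among the rows with entry \<open>a\<close> in column \<open>u\<close>, the other two columns show all four pairs\<close>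
    have "{0..<2} \<times> {0..<2} \<subseteq> (\<lambda>i. (A i v, A i w)) ` L u a"
    proof clarify
      fix b c :: nat assume "b \<in> {0..<2}" "c \<in> {0..<2}"
      then have "\<exists>i\<in>{1..n}. \<forall>x\<in>e. A i x = (if x = u then a else if x = v then b else c)"
        using \<open>a < 2\<close> by (intro covering_arrayD[OF A e(1)]) auto
      then obtain i where i: "i \<in> {1..n}"
        "\<And>x. x \<in> e \<Longrightarrow> A i x = (if x = u then a else if x = v then b else c)"
        by blast
      have "v \<in> e - {u}" "w \<in> e - {u}"
        using vw by simp_all
      then have "i \<in> L u a" "A i v = b" "A i w = c"
        using i vw(2) e(2) by (simp_all add: L_def)
      then show "(b, c) \<in> (\<lambda>i. (A i v, A i w)) ` L u a"
        by (intro image_eqI[of _ _ i]) simp_all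
    qed
    then have "card ({0..<2::nat} \<times> {0..<2::nat}) \<le> card (L u a)"
      by (rule surj_card_le[rotated]) (simp add: L_def)
    then show ?thesis
      by simp
  qed
  have vert: "f v \<in> QI3_verts n" if "v \<in> verts H" for v
  proof -
    have "v \<in> \<Union>(hyperedges H)"
      using H that by (simp add: uniform_def hypergraph_def)
    then obtain e where "e \<in> hyperedges H" "v \<in> e"
      by blast
    then have "{L v 0, {1..n} - L v 0} \<in> QI3_verts n"
    proof (intro QI3_vertsI)
      show "L v 0 \<subseteq> {1..n}"
        by (auto simp: L_def)
    qed (use big compl that in auto)
    then show ?thesis
      by (simp only: f_def compl[OF that])
  qed
  have "f ` e \<in> hyperedges (QI3 n)" if e: "e \<in> hyperedges H" for e
  proof -
    have cells: "\<exists>i. \<forall>v\<in>e. i \<in> g v" if g: "\<And>v. v \<in> e \<Longrightarrow> g v \<in> f v" for g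
    proof -
      have "\<exists>i\<in>{1..n}. \<forall>v\<in>e. A i v = (if g v = L v 0 then 0 else 1)"
        by (rule covering_arrayD[OF A e]) simp
      then obtain i where i: "i \<in> {1..n}" "\<forall>v\<in>e. A i v = (if g v = L v 0 then 0 else 1)"
        by blast
      have "i \<in> g v" if "v \<in> e" for v
      proof (cases "g v = L v 0")
        case True
        then show ?thesis
          using i that by (simp add: L_def)
      next
        case False
        then have "g v = L v 1"
          using g[OF that] by (simp add: f_def)
        then show ?thesis
          using i that False by (simp add: L_def)
      qed
      then show ?thesis
        by blast
    qed
    have "inj_on f e"
    proof (rule inj_onI, rule ccontr)
      fix u v assume uv: "u \<in> e" "v \<in> e" "f u = f v" "u \<noteq> v"
      \<comment> \<open>equal splits have disjoint classes \<open>L u 0\<close> and \<open>L u 1\<close>, contrary to \<open>cells\<close>\<close>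
      have "\<exists>i. \<forall>w\<in>e. i \<in> (if w = u then L u 0 else if w = v then L u 1 else L w 0)"
        using uv(3) by (intro cells) (auto simp: f_def)
      then obtain i where i: "\<And>w. w \<in> e \<Longrightarrow>
          i \<in> (if w = u then L u 0 else if w = v then L u 1 else L w 0)"
        by blast
      show False
        using i[OF uv(1)] i[OF uv(2)] uv(4) by (simp add: L_def)
    qed
    show ?thesis
    proof (rule QI3_edgeI)
      show "f ` e \<subseteq> QI3_verts n"
        using vert edge3(3)[OF e] by blast
      show "card (f ` e) = 3"
        using edge3[OF e] \<open>inj_on f e\<close> by (simp add: card_image)
      show "\<exists>i. \<forall>p\<in>f ` e. i \<in> h p" if "\<And>p. p \<in> f ` e \<Longrightarrow> h p \<in> p" for h
        using cells[of "\<lambda>v. h (f v)"] that by auto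
    qed
  qed
  then show ?thesis
    using vert by (intro exI[of _ f]) (auto simp: homomorphism_def QI3_def)
qed

text \<open>In each split one class is chosen to carry the entry \<open>0\<close>. A tuple prescribed on a hyperedge
  then selects one class from each of its splits, and any common point of these classes is a row
  showing the tuple.\<close>

lemma covering_array_if_homomorphism:
  assumes H: "uniform 3 H" and f: "homomorphism H (QI3 n) f" and "n > 0"
  shows "\<exists>A. covering_array n H 2 A"
proof -
  define X where "X v = (SOME P. P \<in> f v)" for v
  define A where "A i v = (if i \<in> X v then 0 else 1 :: nat)" for i v
  have vert: "f v \<in> QI3_verts n" if "v \<in> verts H" for v
    using f that by (auto simp: homomorphism_def QI3_def)
  have X: "f v = {X v, {1..n} - X v}" if "v \<in> verts H" for v
  proof -
    have "f v \<noteq> {}"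
      using vert[OF that] by (auto simp: QI3_verts_def)
    then have "X v \<in> f v"
      by (simp add: X_def some_in_eq)
    then show ?thesis
      using QI3_vertsD(1)[OF vert[OF that]] by simp
  qed
  have "\<exists>i\<in>{1..n}. \<forall>v\<in>e. A i v = t v" if e: "e \<in> hyperedges H" and t: "t \<in> e \<rightarrow>\<^sub>E {0..<2}" for e t
  proof -
    have fe: "f ` e \<in> hyperedges (QI3 n)"
      using f e by (auto simp: homomorphism_def)
    have e3: "card e = 3" "e \<subseteq> verts H"
      using H e by (auto simp: uniform_def hypergraph_def)
    have "inj_on f e"
      using homomorphism_inj_on_edge[OF H f e] .
    define h where "h p = (let v = inv_into e f p in if t v = 0 then X v else {1..n} - X v)" for p
    have h: "h (f v) = (if t v = 0 then X v else {1..n} - X v)" if "v \<in> e" for v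
      using that \<open>inj_on f e\<close> by (simp add: h_def)
    have hin: "h (f v) \<in> f v" if "v \<in> e" for v
      using X[of v] h[OF that] that e3 by auto
    have "\<exists>i. \<forall>p\<in>f ` e. i \<in> h p"
      using hin by (intro QI3_edge_cells[OF fe]) blast
    then obtain i where i: "\<forall>p\<in>f ` e. i \<in> h p"
      by blast
    have "A i v = t v" if "v \<in> e" for v
    proof -
      have "i \<in> h (f v)" "t v < 2"
        using i that t by auto
      then show ?thesis
        using h[OF that] by (auto simp: A_def split: if_splits)
    qed
    moreover have "i \<in> {1..n}"
    proof -
      have "e \<noteq> {}"
        using e3(1) by auto
      then obtain v where v: "v \<in> e"
        by blast
      then have "h (f v) \<subseteq> {1..n}"
        using e3(2) by (intro QI3_vertsD(2)[OF vert hin]) auto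
      then show ?thesis
        using i v by blast
    qed
    ultimately show ?thesis
      by blast
  qed
  then have "covering_array n H 2 A"
    using \<open>n > 0\<close> by (auto simp: covering_array_def A_def)
  then show ?thesis
    by blast
qed

section \<open>Existence of covering arrays\<close>

text \<open>Surplus rows repeat the first one.\<close>

lemma covering_array_mono:
  assumes "covering_array m H g A" "m \<le> n"
  shows "\<exists>A'. covering_array n H g A'"
proof -
  have m: "m > 0" "g > 0" "\<And>i v. i \<in> {1..m} \<Longrightarrow> v \<in> verts H \<Longrightarrow> A i v \<in> {0..<g}"
    using assms(1) unfolding covering_array_def by blast+
  have "covering_array n H g (\<lambda>i. A (if i \<le> m then i else 1))"
    unfolding covering_array_def
  proof (intro conjI ballI)
    show "A (if i \<le> m then i else 1) v \<in> {0..<g}" if "i \<in> {1..n}" "v \<in> verts H" for i v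
      using that m by auto
    fix e t assume "e \<in> hyperedges H" "t \<in> e \<rightarrow>\<^sub>E {0..<g}"
    then have "\<exists>i\<in>{1..m}. \<forall>v\<in>e. A i v = t v"
      by (intro covering_arrayD[OF assms(1)]) auto
    then obtain i where i: "i \<in> {1..m}" "\<And>v. v \<in> e \<Longrightarrow> A i v = t v"
      by blast
    show "\<exists>i\<in>{1..n}. \<forall>v\<in>e. A (if i \<le> m then i else 1) v = t v"
      using i assms(2) by (intro bexI[of _ i]) auto
  qed (use m assms(2) in auto)
  then show ?thesis
    by blast
qed

text \<open>Without the existence of some array, \<open>CAN\<close> would be the least element of an empty set and
  carry no information. All maps from the vertices to the symbols serve as rows.\<close>

lemma covering_array_exists:
  assumes H: "hypergraph H" and "g > 0"
  shows "\<exists>n A. covering_array n H g A"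
proof -
  define F where "F = verts H \<rightarrow>\<^sub>E {0..<g}"
  have "finite F"
    using H by (auto simp: F_def hypergraph_def intro: finite_PiE)
  then obtain A where A: "bij_betw A {1..card F} F"
    using ex_bij_betw_nat_finite_1 by blast
  have "F \<noteq> {}"
    using \<open>g > 0\<close> by (auto simp: F_def PiE_eq_empty_iff)
  have "covering_array (card F) H g A"
    unfolding covering_array_def
  proof (intro conjI ballI)
    show "card F > 0"
      using \<open>F \<noteq> {}\<close> \<open>finite F\<close> by (simp add: card_gt_0_iff)
    show "A i v \<in> {0..<g}" if "i \<in> {1..card F}" "v \<in> verts H" for i v
      using bij_betwE[OF A] that by (auto simp: F_def PiE_iff)
    fix e t assume e: "e \<in> hyperedges H" and t: "t \<in> e \<rightarrow>\<^sub>E {0..<g}"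
    define t' where "t' = restrict (\<lambda>v. if v \<in> e then t v else 0) (verts H)"
    have "t' \<in> A ` {1..card F}"
      unfolding bij_betw_imp_surj_on[OF A] using t \<open>g > 0\<close> by (auto simp: F_def t'_def)
    then obtain i where "i \<in> {1..card F}" "A i = t'"
      by blast
    moreover have "e \<subseteq> verts H"
      using H e by (auto simp: hypergraph_def)
    ultimately show "\<exists>i\<in>{1..card F}. \<forall>v\<in>e. A i v = t v"
      by (intro bexI[of _ i]) (auto simp: t'_def)
  qed fact
  then show ?thesis
    by blast
qed

section \<open>Colour maps and strong colourings\<close>

lemma strong_chromatic_number_le:
  assumes V: "finite (verts H)" and K: "finite K" "c ` verts H \<subseteq> K"
    and c: "\<And>e. e \<in> hyperedges H \<Longrightarrow> inj_on c e"
  shows "strong_chromatic_number H \<le> card K"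
proof -
  define C where "C = (\<lambda>i. {v \<in> verts H. c v = i}) ` c ` verts H"
  have "strong_colouring H C (card C)"
    unfolding strong_colouring_def
  proof (intro conjI ballI impI notI)
    show "partition_on (verts H) C"
      by (auto simp: partition_on_def disjoint_def C_def)
    show "finite C"
      using V by (simp add: C_def)
    show False if "e \<in> hyperedges H" "u \<in> e" "v \<in> e" "u \<noteq> v" "\<exists>X\<in>C. u \<in> X \<and> v \<in> X" for e u v
      using c[OF that(1)] that by (auto simp: C_def inj_on_def)
  qed simp
  then have "strong_chromatic_number H \<le> card C"
    unfolding strong_chromatic_number_def by (blast intro: Least_le)
  also have "card C \<le> card (c ` verts H)"
    using V by (simp add: C_def card_image_le)
  also have "\<dots> \<le> card K"
    using K by (simp add: card_mono)
  finally show ?thesis .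
qed

section \<open>Families of splits without a crossing pair\<close>

text \<open>Applied with \<open>K\<close> the common core \<open>T\<close> or \<open>S\<close> of two members of a family, and with the
  complement of a set disjoint from \<open>K\<close> in the place of \<open>Y\<close>.\<close>

lemma core_diff_le_1:
  assumes "finite X" "K \<subseteq> X" "K \<subseteq> Y" "card X \<le> Suc (card K)"
  shows "card (X - Y) \<le> 1"
proof -
  have "card (X - Y) \<le> card (X - K)"
    using assms by (intro card_mono) auto
  also have "\<dots> \<le> 1"
    using assms by (simp add: card_Diff_subset finite_subset)
  finally show ?thesis .
qed

text \<open>A split belongs to the family when one of its two classes satisfies this predicate.\<close>

definition in_class :: "'a set \<Rightarrow> 'a set \<Rightarrow> 'a set \<Rightarrow> 'a set \<Rightarrow> bool" where
  "in_class T S Q X \<longleftrightarrow>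
     card X = 4 \<and> (T \<subseteq> X \<or> X \<subseteq> Q) \<or> card X = 5 \<and> S \<subseteq> X"

text \<open>Members of the star parts of the family share the core \<open>T\<close>, or the core \<open>S\<close> if both are
  \<open>5\<close>-sets, and a member has at most one point outside its own core. A star member meets a
  subset of \<open>Q\<close> outside its core only, hence in at most one point. Two \<open>4\<close>-subsets of the
  \<open>5\<close>-set \<open>Q\<close> differ in at most one point. The fourth cell, outside \<open>X \<union> Y\<close>, is never the one
  that has to be small.\<close>

lemma in_class_not_crossing:
  assumes T: "card T = 3" "T \<subseteq> S" and S: "card S = 4" and Q: "S \<inter> Q = {}" "card Q = 5"
    and X: "in_class T S Q X" and Y: "in_class T S Q Y"
  shows "card (X \<inter> Y) \<le> 1 \<or> card (X - Y) \<le> 1 \<or> card (Y - X) \<le> 1"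
proof -
  have fin: "finite X" "finite Y" "finite Q"
    using X Y Q by (auto simp: in_class_def intro: card_ge_0_finite)
  define star where "star Z \<longleftrightarrow> card Z = 4 \<and> T \<subseteq> Z \<or> card Z = 5 \<and> S \<subseteq> Z" for Z
  have cases: "star Z \<or> card Z = 4 \<and> Z \<subseteq> Q" if "in_class T S Q Z" for Z
    using that by (auto simp: in_class_def star_def)
  have star_star: "card (Z - W) \<le> 1 \<or> card (W - Z) \<le> 1" if "star Z" "star W" "finite Z" "finite W" for Z W
  proof -
    have "card Z = 4 \<and> T \<subseteq> Z \<and> T \<subseteq> W \<or> card W = 4 \<and> T \<subseteq> W \<and> T \<subseteq> Z
        \<or> card Z = 5 \<and> S \<subseteq> Z \<and> S \<subseteq> W"
      using that T(2) by (auto simp: star_def)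
    then show ?thesis
      using core_diff_le_1[of Z T W] core_diff_le_1[of W T Z] core_diff_le_1[of Z S W] T S that(3,4)
      by auto
  qed
  have star_Q: "card (Z \<inter> W) \<le> 1" if "star Z" "W \<subseteq> Q" "finite Z" for Z W
  proof -
    have "S \<subseteq> - W" "T \<subseteq> - W"
      using that(2) T(2) Q(1) by auto
    then have "card (Z - (- W)) \<le> 1"
      using that T S core_diff_le_1[of Z T "- W"] core_diff_le_1[of Z S "- W"]
      by (auto simp: star_def)
    then show ?thesis
      by (simp add: Diff_eq)
  qed
  have Q_Q: "card (X - Y) \<le> 1" if "X \<subseteq> Q" "Y \<subseteq> Q" "card Y = 4"
  proof -
    have "card (X - Y) \<le> card (Q - Y)"
      using that fin by (intro card_mono) auto
    then show ?thesis
      using that fin Q by (simp add: card_Diff_subset)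
  qed
  show ?thesis
    using cases[OF X] cases[OF Y] star_star[of X Y] star_Q[of X Y] star_Q[of Y X] Q_Q fin
    by (auto simp: Int_commute)
qed

section \<open>A strong colouring of \<open>3-QI(10,2)\<close> with 30 colours\<close>

text \<open>The power \<open>k\<close> of the permutation \<open>(1 2 3 4 5)(6 7 8 9 10)\<close>. Subtracting \<open>1\<close> makes the
  residues start at \<open>0\<close>; in the second cycle \<open>x - 6\<close> and \<open>x - 1\<close> agree modulo \<open>5\<close>.\<close>

definition rotate_point :: "nat \<Rightarrow> nat \<Rightarrow> nat" where
  "rotate_point k x = (if x \<le> 5 then (x + k - 1) mod 5 + 1 else (x + k - 1) mod 5 + 6)"

text \<open>An entry \<open>(T, s, Q)\<close> stands for the family of \<open>T\<close>, \<open>S = insert s T\<close> and \<open>Q\<close>. The six entries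
  come from a randomised search by computer that maximised the number of orbits of splits covered
  by the six families: the rotation has \<open>68\<close> orbits on the splits, and six families have
  \<open>6 * 18 = 108\<close> members.\<close>

definition base_triples :: "(nat list \<times> nat \<times> nat list) list" where
  "base_triples =
    [([1,2,6], 8, [3,4,5,7,10]),
     ([3,6,7], 1, [2,4,8,9,10]),
     ([1,4,7], 6, [2,3,8,9,10]),
     ([6,8,9], 7, [2,3,4,5,10]),
     ([4,5,6], 8, [1,2,3,7,10]),
     ([2,6,7], 4, [3,5,8,9,10])]"

definition colours :: "(nat list \<times> nat \<times> nat list) list" where
  "colours =
     [(map (rotate_point k) T, rotate_point k s, map (rotate_point k) Q).
        (T, s, Q) \<leftarrow> base_triples, k \<leftarrow> [0..<5]]"

definition in_colour :: "nat list \<times> nat \<times> nat list \<Rightarrow> nat set \<Rightarrow> bool" where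
  "in_colour c X = (case c of (T, s, Q) \<Rightarrow> in_class (set T) (set (s # T)) (set Q) X)"

lemma length_colours: "length colours = 30"
  by (simp add: colours_def base_triples_def upt_rec)

text \<open>The thirty rotated triples written out, so that the enumeration below does not recompute them
  for every set.\<close>

schematic_goal colours_eq: "colours = ?cs"
  unfolding colours_def base_triples_def rotate_point_def by (simp add: upt_rec)

text \<open>The side conditions under which \<open>in_class_not_crossing\<close> applies to every colour.\<close>

lemma colours_shape:
  "list_all (\<lambda>(T, s, Q). distinct T \<and> length T = 3 \<and> s \<notin> set T \<and>
     distinct Q \<and> length Q = 5 \<and> set (s # T) \<inter> set Q = {} \<and> set (s # T) \<subseteq> {1..10}) colours"
  unfolding colours_eq by simp

text \<open>The \<open>4\<close>-sets and the \<open>5\<close>-sets are enumerated and tested one by one. A \<open>5|5\<close> split may be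
  represented by either class, so a \<open>5\<close>-set may contain \<open>S\<close> or be disjoint from it.\<close>

lemma cover4:
  "list_all (\<lambda>X. length X = 4 \<longrightarrow>
     list_ex (\<lambda>(T, s, Q). list_all (\<lambda>x. x \<in> set X) T \<or> list_all (\<lambda>x. x \<in> set Q) X) colours)
   (subseqs [1..<11])"
  unfolding colours_eq by code_simp

lemma cover5:
  "list_all (\<lambda>X. length X = 5 \<longrightarrow>
     list_ex (\<lambda>(T, s, Q). list_all (\<lambda>x. x \<in> set X) (s # T)
       \<or> list_all (\<lambda>x. x \<notin> set X) (s # T)) colours)
   (subseqs [1..<11])"
  unfolding colours_eq by code_simp

lemma in_colour_not_crossing:
  assumes "c \<in> set colours" "in_colour c X" "in_colour c Y"
  shows "card (X \<inter> Y) \<le> 1 \<or> card (X - Y) \<le> 1 \<or> card (Y - X) \<le> 1"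
proof -
  obtain T s Q where c: "c = (T, s, Q)"
    by (cases c)
  then have "distinct T" "length T = 3" "s \<notin> set T" "distinct Q" "length Q = 5"
    "set (s # T) \<inter> set Q = {}"
    using colours_shape assms(1) by (auto simp: list_all_iff)
  then show ?thesis
    using assms(2,3) c
    by (intro in_class_not_crossing[of "set T" "set (s # T)" "set Q"])
       (auto simp: in_colour_def distinct_card)
qed

lemma subset_as_subseq:
  assumes "X \<subseteq> {1..10::nat}"
  obtains xs where "xs \<in> set (subseqs [1..<11])" "set xs = X" "length xs = card X"
proof -
  have "X \<in> set ` set (subseqs [1..<11])"
    using assms by (auto simp: subseqs_powset)
  then obtain xs where xs: "xs \<in> set (subseqs [1..<11])" "set xs = X"
    by blast
  then have "distinct xs"
    using subseqs_distinctD by fastforce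
  then show thesis
    using that xs distinct_card by fastforce
qed

lemma in_colour_4:
  assumes "X \<subseteq> {1..10}" "card X = 4"
  shows "\<exists>c\<in>set colours. in_colour c X"
proof -
  obtain xs where xs: "xs \<in> set (subseqs [1..<11])" "set xs = X" "length xs = card X"
    using subset_as_subseq[OF assms(1)] .
  then have "list_ex (\<lambda>(T, s, Q). list_all (\<lambda>x. x \<in> X) T \<or> list_all (\<lambda>x. x \<in> set Q) xs) colours"
    using cover4 assms(2) unfolding list_all_iff[of _ "subseqs [1..<11]"] by auto
  then show ?thesis
    using xs assms(2) by (fastforce simp: list_ex_iff list_all_iff in_colour_def in_class_def)
qed

lemma in_colour_5:
  assumes "X \<subseteq> {1..10}" "card X = 5"
  shows "\<exists>c\<in>set colours. in_colour c X \<or> in_colour c ({1..10} - X)"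
proof -
  obtain xs where xs: "xs \<in> set (subseqs [1..<11])" "set xs = X" "length xs = card X"
    using subset_as_subseq[OF assms(1)] .
  then have "list_ex (\<lambda>(T, s, Q). list_all (\<lambda>x. x \<in> X) (s # T)
      \<or> list_all (\<lambda>x. x \<notin> X) (s # T)) colours"
    using cover5 assms(2) unfolding list_all_iff[of _ "subseqs [1..<11]"] by auto
  then obtain T s Q where c: "(T, s, Q) \<in> set colours"
    and TX: "set (s # T) \<subseteq> X \<or> set (s # T) \<inter> X = {}"
    by (fastforce simp: list_ex_iff list_all_iff)
  have "card ({1..10} - X) = 5"
    using assms by (simp add: card_Diff_subset finite_subset)
  moreover have "set (s # T) \<subseteq> {1..10}"
    using c colours_shape by (fastforce simp: list_all_iff)
  ultimately show ?thesis
    using c TX assms(2) by (intro bexI[OF _ c]) (auto simp: in_colour_def in_class_def)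
qed

lemma QI3_10_colour_exists:
  assumes "p \<in> QI3_verts 10"
  shows "\<exists>c\<in>set colours. \<exists>X\<in>p. in_colour c X"
proof -
  obtain P where "P \<in> p"
    using assms by (fastforce simp: QI3_verts_def)
  note P = QI3_vertsD[OF assms \<open>P \<in> p\<close>]
  then have "{1..10} - P \<in> p"
    by blast
  note P' = QI3_vertsD[OF assms this]
  have "card ({1..10} - P) = 10 - card P"
    using P(2) by (simp add: card_Diff_subset finite_subset)
  then consider "card P = 4" | "card P = 5" | "card ({1..10} - P) = 4"
    using P(3) P'(3) by linarith
  then show ?thesis
  proof cases
    case 1
    then show ?thesis
      using in_colour_4[OF P(2)] \<open>P \<in> p\<close> by blast
  next
    case 2
    then show ?thesis
      using in_colour_5[OF P(2)] \<open>P \<in> p\<close> \<open>{1..10} - P \<in> p\<close> by blast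
  next
    case 3
    then show ?thesis
      using in_colour_4[OF P'(2)] \<open>{1..10} - P \<in> p\<close> by blast
  qed
qed

lemma QI3_10_strong_colouring:
  "\<exists>col. col ` QI3_verts 10 \<subseteq> set colours \<and> (\<forall>E\<in>hyperedges (QI3 10). inj_on col E)"
proof -
  obtain col where col: "\<And>p. p \<in> QI3_verts 10 \<Longrightarrow> col p \<in> set colours \<and> (\<exists>X\<in>p. in_colour (col p) X)"
    using QI3_10_colour_exists by metis
  have "inj_on col E" if E: "E \<in> hyperedges (QI3 10)" for E
  proof (rule inj_onI, rule ccontr)
    fix p q assume pq: "p \<in> E" "q \<in> E" "col p = col q" "p \<noteq> q"
    then have V: "p \<in> QI3_verts 10" "q \<in> QI3_verts 10"
      using QI3_edgeD(1)[OF E] by auto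
    obtain X Y where X: "X \<in> p" "in_colour (col p) X" and Y: "Y \<in> q" "in_colour (col p) Y"
      using col[OF V(1)] col[OF V(2)] pq(3) by auto
    have cross: "2 \<le> card (X' \<inter> Y')" if "X' \<in> p" "Y' \<in> q" for X' Y'
      using QI3_edge_crossing[OF E pq(1,2,4) that] .
    have sub: "X \<subseteq> {1..10}" "Y \<subseteq> {1..10}"
      using QI3_vertsD(2) V X Y by blast+
    have "{1..10} - X \<in> p" "{1..10} - Y \<in> q"
      using QI3_vertsD(1) V X(1) Y(1) by blast+
    moreover have "X \<inter> ({1..10} - Y) = X - Y" "({1..10} - X) \<inter> Y = Y - X"
      using sub by auto
    ultimately have "2 \<le> card (X \<inter> Y)" "2 \<le> card (X - Y)" "2 \<le> card (Y - X)"
      using cross X(1) Y(1) by metis+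
    then show False
      using in_colour_not_crossing[OF _ X(2) Y(2)] col[OF V(1)] by fastforce
  qed
  then show ?thesis
    using col by (intro exI[of _ col]) auto
qed

section \<open>Covering array numbers of hypergraphs with large strong chromatic number\<close>

lemma strong_chromatic_number_le_30:
  assumes H: "uniform 3 H" and f: "homomorphism H (QI3 10) f"
  shows "strong_chromatic_number H \<le> 30"
proof -
  obtain col where col: "col ` QI3_verts 10 \<subseteq> set colours"
    "\<And>E. E \<in> hyperedges (QI3 10) \<Longrightarrow> inj_on col E"
    using QI3_10_strong_colouring by blast
  have "strong_chromatic_number H \<le> card (set colours)"
  proof (rule strong_chromatic_number_le[where c = "col \<circ> f"])
    show "finite (verts H)"
      using H by (simp add: uniform_def hypergraph_def)
    show "(col \<circ> f) ` verts H \<subseteq> set colours"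
      using col(1) f by (auto simp: homomorphism_def QI3_def)
    show "inj_on (col \<circ> f) e" if "e \<in> hyperedges H" for e
      using homomorphism_inj_on_edge[OF H f that] col(2)[of "f ` e"] f that
      by (auto simp: homomorphism_def intro: comp_inj_on)
  qed simp
  also have "\<dots> \<le> 30"
    using card_length[of colours] by (simp add: length_colours)
  finally show ?thesis .
qed

theorem mainTheorem3:
  fixes H :: "'a hypergraph"
  assumes "uniform 3 H"
    and "strong_chromatic_number H > 30"
  shows "(\<nexists>f. homomorphism H (QI3 10) f) \<and>
    (\<nexists>A. covering_array 10 H 2 A) \<and>
    CAN H 2 \<ge> 11 \<and>
    ((\<exists>f. homomorphism H (QI3 11) f) \<longrightarrow> CAN H 2 = 11)"
proof -
  have no_hom: "\<nexists>f. homomorphism H (QI3 10) f"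
    using strong_chromatic_number_le_30[OF assms(1)] assms(2) by fastforce
  then have no_array: "\<nexists>A. covering_array 10 H 2 A"
    using homomorphism_if_covering_array[OF assms(1)] by blast
  have "\<exists>n A. covering_array n H 2 A"
    using assms(1) by (intro covering_array_exists) (simp_all add: uniform_def)
  then have "\<exists>A. covering_array (CAN H 2) H 2 A"
    unfolding CAN_def by (rule LeastI_ex)
  then have ge: "CAN H 2 \<ge> 11"
    using no_array covering_array_mono[of "CAN H 2" H 2 _ 10] by (cases "CAN H 2 \<le> 10") auto
  have "CAN H 2 = 11" if "homomorphism H (QI3 11) f" for f
  proof -
    have "\<exists>A. covering_array 11 H 2 A"
      using covering_array_if_homomorphism[OF assms(1) that] by simp
    then have "CAN H 2 \<le> 11"
      unfolding CAN_def by (rule Least_le)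
    then show ?thesis
      using ge by simp
  qed
  then show ?thesis
    using no_hom no_array ge by blast
qed

end
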